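(* Let $d\ge 2$ and let $C_{d+1}$ be the cycle graph on $d+1$ vertices. Write the Ehrhart polynomial of $P_{C_{d+1}}^\ast$ as $$E_{P_{C_{d+1}}^\ast}(n)=\sum_{j=0}^d a_j\,n^j(1+n)^{d-j}$$ with real numbers $a_0,\ldots,a_d$. Then $a_i>0$ and $a_{d-i}>0$ for $i=0,1,2$.
   Context: For a connected finite simple graph $G$ on vertex set $[d+1]$, the symmetric edge polytope $P_G$ is the convex hull of $\{\pm(e_v-e_w)\mid vw\in E(G)\}\subset\mathbb{R}^{d+1}$; it lies in the hyperplane $\sum x_i=0$. Identify this hyperplane's lattice $\mathbb{Z}^{d+1}\cap\{\sum x_i=0\}$ with $\mathbb{Z}^d$ by forgetting the last coordinate; under this identification $P_G$ becomes a $d$-dimensional reflexive lattice polytope in $\mathbb{R}^d$, and $P_G^\ast=\{y\in\mathbb{R}^d\mid\langle x,y\rangle\le1\ \forall x\in P_G\}$ is its polar dual. For the cycle, $P_{C_{d+1}}^\ast$ is unimodularly equivalent to $\{(x_1,\ldots,x_d)\in\mathbb{R}^d\mid -1\le x_i\le 1\ (1\le i\le d),\ -1\le x_1+\cdots+x_d\le 1\}$. The Ehrhart polynomial $E_P(n)$ of a lattice polytope $P\subset\mathbb{R}^d$ satisfies $E_P(n)=|nP\cap\mathbb{Z}^d|$ for integers $n>0$. *)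

theory Defs
  imports "HOL-Analysis.Analysis" "HOL-Computational_Algebra.Polynomial"
begin

text \<open>A simple graph on the vertex type \<open>'v\<close> is given by its set of edges, each edge being the
  set of its two endpoints.\<close>

definition cycle_graph :: "'v::finite set set \<Rightarrow> bool" where
  "cycle_graph E \<longleftrightarrow> CARD('v) \<ge> 3 \<and>
     (\<exists>c. bij_betw c {..<CARD('v)} (UNIV :: 'v set) \<and>
          E = {{c i, c (Suc i mod CARD('v))} | i. i < CARD('v)})"

definition symmetric_edge_polytope :: "'v::finite set set \<Rightarrow> (real ^ 'v) set" where
  "symmetric_edge_polytope E = convex hull
     ({axis v 1 - axis w 1 | v w. {v, w} \<in> E} \<union> {- (axis v 1 - axis w 1) | v w. {v, w} \<in> E})"

text \<open>With \<open>d = CARD('n)\<close>, the space of dimension \<open>d + 1\<close> is \<open>real ^ 'n option\<close>, where the index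
  \<open>None\<close> plays the role of the last coordinate.\<close>

definition forget_last :: "real ^ 'n::finite option \<Rightarrow> real ^ 'n" where
  "forget_last x = (\<chi> i. x $ Some i)"

definition polar_dual :: "(real ^ 'n::finite) set \<Rightarrow> (real ^ 'n) set" where
  "polar_dual P = {y. \<forall>x\<in>P. x \<bullet> y \<le> 1}"

definition integer_points :: "(real ^ 'n::finite) set" where
  "integer_points = {x. \<forall>i. x $ i \<in> \<int>}"

definition ehrhart_polynomial :: "(real ^ 'n::finite) set \<Rightarrow> real poly" where
  "ehrhart_polynomial P = (THE p. \<forall>n::nat. n > 0 \<longrightarrow>
     poly p (real n) = real (card ((\<lambda>x. real n *\<^sub>R x) ` P \<inter> integer_points)))"

lemma ehrhart_polynomial_eqI:
  assumes "\<And>n::nat. n > 0 \<Longrightarrow>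
    poly p (real n) = real (card ((\<lambda>x. real n *\<^sub>R x) ` P \<inter> integer_points))"
  shows "ehrhart_polynomial P = p"
  unfolding ehrhart_polynomial_def
proof (rule the_equality)
  show "\<forall>n::nat. n > 0 \<longrightarrow>
     poly p (real n) = real (card ((\<lambda>x. real n *\<^sub>R x) ` P \<inter> integer_points))"
    using assms by blast
next
  fix q
  assume q: "\<forall>n::nat. n > 0 \<longrightarrow>
     poly q (real n) = real (card ((\<lambda>x. real n *\<^sub>R x) ` P \<inter> integer_points))"
  have "real ` {0<..} \<subseteq> {x. poly (q - p) x = 0}"
    using q assms by auto
  moreover have "infinite (real ` {0<..})"
    by (simp add: finite_image_iff infinite_Ioi)
  ultimately have "infinite {x. poly (q - p) x = 0}"
    using finite_subset by blast
  then show "q = p"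
    using poly_roots_finite[of "q - p"] by auto
qed

text \<open>Every real polynomial of degree at most \<open>d\<close> is a linear combination of the
  polynomials \<open>x ^ j * (1 + x) ^ (d - j)\<close>.\<close>

lemma expansion_exists:
  fixes p :: "real poly"
  assumes "degree p \<le> d"
  shows "\<exists>a. \<forall>x. poly p x = (\<Sum>j\<le>d. a j * x ^ j * (1 + x) ^ (d - j))"
  using assms
proof (induction d arbitrary: p)
  case 0
  then obtain c where "p = [:c:]"
    using degree_eq_zeroE by blast
  then show ?case by (intro exI[of _ "\<lambda>_. c"]) auto
next
  case (Suc d)
  define r where "r = p - smult (poly p 0) ([:1, 1:] ^ Suc d)"
  have "poly r 0 = 0" by (simp add: r_def)
  then obtain q where q: "r = [:0, 1:] * q"
    using poly_eq_0_iff_dvd[of r 0] by auto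
  have "degree ([:1, 1:] ^ Suc d :: real poly) \<le> Suc d"
    using degree_power_le[of "[:1, 1:] :: real poly" "Suc d"] by simp
  then have "degree r \<le> Suc d"
    unfolding r_def using Suc.prems by (intro degree_diff_le) (auto intro: order_trans degree_smult_le)
  then have "degree q \<le> d"
    using q by (cases "q = 0") (auto simp: degree_mult_eq)
  then obtain b where b: "\<And>x. poly q x = (\<Sum>j\<le>d. b j * x ^ j * (1 + x) ^ (d - j))"
    using Suc.IH by blast
  define a where "a j = (case j of 0 \<Rightarrow> poly p 0 | Suc i \<Rightarrow> b i)" for j
  have "poly p x = (\<Sum>j\<le>Suc d. a j * x ^ j * (1 + x) ^ (Suc d - j))" for x
  proof -
    have "poly p x = poly p 0 * (1 + x) ^ Suc d + poly r x"
      by (simp add: r_def algebra_simps)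
    also have "poly r x = (\<Sum>j\<le>d. b j * x ^ Suc j * (1 + x) ^ (d - j))"
      by (simp add: q b sum_distrib_left algebra_simps)
    finally show ?thesis
      by (simp add: sum.atMost_Suc_shift a_def del: sum.atMost_Suc)
  qed
  then show ?case by blast
qed

end

theory Submission
  imports Defs "HOL-Computational_Algebra.Formal_Power_Series"
begin

text \<open>Put \<open>D = d + 1\<close>. Differences along the cycle identify the lattice points of the \<open>n\<close>-th dilate
  with the integer sequences of length \<open>D\<close> in \<open>[-n, n]\<close> with sum zero. Shifting by \<open>n\<close>, their number
  is a coefficient of \<open>(1 + X + \<dots> + X\<^bsup>2n\<^esup>)\<^bsup>D\<^esup>\<close>, which is an alternating sum of binomial coefficients,
  polynomial in \<open>n\<close>. Each of its terms is, up to the sign \<open>(-1)\<^bsup>d\<^esup>\<close>, invariant under \<open>n \<mapsto> -1 - n\<close>, so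
  \<open>j \<mapsto> a (d - j)\<close> satisfies the same expansion as \<open>a\<close> and only \<open>a 0\<close>, \<open>a 1\<close>, \<open>a 2\<close> matter. These are
  linear combinations of the three lowest coefficients of the Ehrhart polynomial, which have closed forms
  in harmonic numbers: \<open>a 0 = 1\<close>, \<open>a 1 = D * L - d\<close> and
  \<open>a 2 = D\<^sup>2 * (L - harm2 f) + d * (d - 1) / 2\<close> (minus \<open>4\<close> if \<open>d\<close> is odd), where \<open>f = d div 2\<close> and
  \<open>L = 2 * harm d - harm f - harm (d - f)\<close>.\<close>

section \<open>Counting bounded sequences with prescribed sum by generating functions\<close>

text \<open>A coefficient of a power is a sum over \<open>natpermute\<close> of products of
  coefficients of the base. Here each coefficient is 0 or 1, so each product is the indicator that
  all entries are at most \<open>b\<close>.\<close>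

lemma card_bounded_natpermute:
  "of_nat (card {l \<in> natpermute s (Suc d). \<forall>x\<in>set l. x \<le> b}) =
     fps_nth ((\<Sum>i\<le>b. fps_X ^ i :: 'a::comm_ring_1 fps) ^ Suc d) s"
proof -
  let ?g = "\<Sum>i\<le>b. fps_X ^ i :: 'a fps"
  have coeff: "fps_nth ?g i = (if i \<le> b then 1 else 0)" for i
    by (simp add: fps_sum_nth fps_X_power_nth if_distrib cong: if_cong)
  have "(\<Prod>j\<in>{0..d}. fps_nth ?g (l ! j)) = (if \<forall>x\<in>set l. x \<le> b then 1 else 0)"
    if "l \<in> natpermute s (Suc d)" for l
  proof -
    have len: "length l = Suc d" using that by (simp add: natpermute_def)
    show ?thesis
    proof (cases "\<forall>x\<in>set l. x \<le> b")
      case True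
      then show ?thesis using len by (auto simp: coeff intro!: prod.neutral)
    next
      case False
      then obtain j where "j < Suc d" "\<not> l ! j \<le> b"
        using len by (metis in_set_conv_nth)
      then show ?thesis using False by (auto simp: coeff intro!: prod_zero bexI[of _ j])
    qed
  qed
  then have "fps_nth (?g ^ Suc d) s =
      (\<Sum>l\<in>natpermute s (Suc d). if \<forall>x\<in>set l. x \<le> b then 1 else 0)"
    unfolding fps_power_nth_Suc Suc_eq_plus1[symmetric] by (intro sum.cong) auto
  also have "\<dots> = of_nat (card {l \<in> natpermute s (Suc d). \<forall>x\<in>set l. x \<le> b})"
    by (simp add: sum.If_cases natpermute_finite Int_def)
  finally show ?thesis by simp
qed

text \<open>The base equals (1 - X^(b+1)) / (1 - X). The numerator of its power is expanded by the
  binomial theorem, and the inverse power of 1 - X is the negative binomial series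
  \<open>?h\<close>.\<close>

lemma geometric_power_nth:
  "fps_nth ((\<Sum>i\<le>b. fps_X ^ i :: real fps) ^ Suc d) s =
     (\<Sum>k\<le>Suc d. (-1) ^ k * real (Suc d choose k) *
        (if k * Suc b \<le> s then real ((d + (s - k * Suc b)) choose d) else 0))"
proof -
  let ?g = "\<Sum>i\<le>b. fps_X ^ i :: real fps"
  let ?h = "Abs_fps (\<lambda>k. real ((d + k) choose d))"
  have g: "?g * (1 - fps_X) = 1 - fps_X ^ Suc b"
    by (simp only: one_diff_power_eq lessThan_Suc_atMost mult.commute)
  have h: "inverse ((1 - fps_X) ^ Suc d) = ?h"
    using one_minus_const_fps_X_neg_power'[of "Suc d" "1::real"]
    by (simp add: fps_eq_iff binomial_symmetric[of d "d + _"])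
  have "(1 - fps_X :: real fps) ^ Suc d * ?h = 1"
    unfolding h[symmetric] by (rule inverse_mult_eq_1') (simp add: fps_nth_power_0)
  then have "?g ^ Suc d = (?g * (1 - fps_X)) ^ Suc d * ?h"
    by (simp only: power_mult_distrib mult.assoc mult_1_right)
  also have "\<dots> = (1 - fps_X ^ Suc b) ^ Suc d * ?h" by (simp only: g)
  also have "(1 - fps_X ^ Suc b :: real fps) ^ Suc d =
      (\<Sum>k\<le>Suc d. of_nat (Suc d choose k) * (- (fps_X ^ Suc b)) ^ k)"
    using binomial_ring[of "- (fps_X ^ Suc b) :: real fps" 1 "Suc d"] by simp
  also have "\<dots> = (\<Sum>k\<le>Suc d. fps_const ((-1) ^ k * real (Suc d choose k)) * fps_X ^ (k * Suc b))"
  proof (intro sum.cong refl)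
    fix k
    have "(- (fps_X ^ Suc b)) ^ k = fps_const ((-1) ^ k) * (fps_X :: real fps) ^ (k * Suc b)"
      unfolding power_minus[of "fps_X ^ Suc b"] power_mult[symmetric] mult.commute[of "Suc b"]
      by (metis fps_const_1_eq_1 fps_const_neg fps_const_power)
    then show "of_nat (Suc d choose k) * (- (fps_X ^ Suc b)) ^ k =
        fps_const ((-1) ^ k * real (Suc d choose k)) * (fps_X :: real fps) ^ (k * Suc b)"
      by (simp only: fps_of_nat[symmetric] fps_const_mult[symmetric] mult_ac)
  qed
  finally have "fps_nth (?g ^ Suc d) s =
      fps_nth (\<Sum>k\<le>Suc d. fps_const ((-1) ^ k * real (Suc d choose k)) * (fps_X ^ (k * Suc b) * ?h)) s"
    by (simp only: sum_distrib_right mult.assoc)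
  also have "\<dots> = (\<Sum>k\<le>Suc d. (-1) ^ k * real (Suc d choose k) *
        (if k * Suc b \<le> s then real ((d + (s - k * Suc b)) choose d) else 0))"
    by (simp only: fps_sum_nth fps_mult_left_const_nth fps_X_power_mult_nth fps_nth_Abs_fps)
       (intro sum.cong refl, auto)
  finally show ?thesis .
qed

text \<open>The summand of index \<open>k\<close> is the polynomial in \<open>n\<close> given by the binomial coefficient
  \<open>(D - 2 * k) * n - k + d\<close> choose \<open>d\<close>, where \<open>D = d + 1\<close>.\<close>

definition cycle_ehrhart :: "nat \<Rightarrow> real poly" where
  "cycle_ehrhart d = (\<Sum>k\<le>d div 2. smult ((-1) ^ k * real (Suc d choose k) / fact d)
     (\<Prod>i=1..d. [:real i - real k, real (Suc d) - 2 * real k:]))"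

lemma fact_mult_binomial_eq_prod: "fact d * real ((d + m) choose d) = (\<Prod>i=1..d. real m + real i)"
proof -
  have "(\<Prod>i=1..d. real m + real i) = pochhammer (real m + 1) d"
    by (simp add: pochhammer_prod prod.atLeast_Suc_atMost_Suc_shift[of _ 0] prod.atLeast1_atMost_eq lessThan_atLeast0 algebra_simps)
  moreover have "real ((d + m) choose d) = pochhammer (real m + 1) d / fact d"
    by (simp add: binomial_gbinomial gbinomial_pochhammer' algebra_simps)
  ultimately show ?thesis by simp
qed

text \<open>The guard in the inclusion-exclusion sum depends on both \<open>k\<close> and
  \<open>n\<close>, which would spoil polynomiality. It can be replaced by
  \<open>k \<le> d div 2\<close>: beyond that bound it always fails, and below it a failing guard
  only drops terms whose polynomial is zero anyway.\<close>

lemma card_bounded_natpermute_eq_poly: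
  "real (card {l \<in> natpermute (n * Suc d) (Suc d). \<forall>x\<in>set l. x \<le> 2 * n}) =
     poly (cycle_ehrhart d) (real n)"
proof -
  let ?s = "n * Suc d" and ?m = "Suc (2 * n)"
  let ?t = "\<lambda>k. if k * ?m \<le> ?s then real ((d + (?s - k * ?m)) choose d) else 0"
  let ?P = "\<lambda>k. \<Prod>i=1..d. (real (Suc d) - 2 * real k) * real n - real k + real i"
  have zero: "?t k = 0" if "k > d div 2" for k
  proof -
    have "Suc d \<le> 2 * k" using that by linarith
    then have "n * Suc d \<le> n * (2 * k)" by (rule mult_le_mono2)
    then have "?s < k * ?m" using that by (simp add: algebra_simps)
    then show ?thesis by simp
  qed
  have term_eq: "fact d * ?t k = ?P k" if "k \<le> d div 2" for k
  proof (cases "k * ?m \<le> ?s")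
    case True
    have "real (?s - k * ?m) = (real (Suc d) - 2 * real k) * real n - real k"
      using True by (simp add: of_nat_diff algebra_simps)
    then show ?thesis using True fact_mult_binomial_eq_prod[of d "?s - k * ?m"] by simp
  next
    case False
    have le: "2 * k \<le> d" using that by linarith
    \<comment> \<open>The value (D - 2 * k) * n - k is the negative integer -r with 1 \<le> r \<le>
      k \<le> d, so the factor with index \<open>r\<close> vanishes.\<close>
    define r where "r = k * ?m - ?s"
    have "n * (2 * k) \<le> n * Suc d" using le by (intro mult_le_mono2) simp
    then have "r \<le> k" unfolding r_def by (simp add: algebra_simps)
    then have r: "r \<in> {1..d}" using le False by (auto simp: r_def)
    have "real r = - ((real (Suc d) - 2 * real k) * real n - real k)"
      using False by (simp add: r_def of_nat_diff algebra_simps)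
    then have "?P k = 0" using r by (intro prod_zero bexI[of _ r]) auto
    then show ?thesis using False by simp
  qed
  have "real (card {l \<in> natpermute ?s (Suc d). \<forall>x\<in>set l. x \<le> 2 * n}) =
     (\<Sum>k\<le>Suc d. (-1) ^ k * real (Suc d choose k) * ?t k)"
    by (simp only: card_bounded_natpermute geometric_power_nth)
  also have "\<dots> = (\<Sum>k\<le>d div 2. (-1) ^ k * real (Suc d choose k) * ?t k)"
    using zero by (intro sum.mono_neutral_right) (auto simp del: binomial_Suc_Suc)
  also have "\<dots> = (\<Sum>k\<le>d div 2. (-1) ^ k * real (Suc d choose k) / fact d * ?P k)"
  proof (intro sum.cong refl)
    fix k assume "k \<in> {..d div 2}"
    then have "?t k = ?P k / fact d" using term_eq[of k] by (simp add: field_simps)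
    then show "(-1) ^ k * real (Suc d choose k) * ?t k =
      (-1) ^ k * real (Suc d choose k) / fact d * ?P k"
      by (simp only: times_divide_eq_left times_divide_eq_right)
  qed
  also have "\<dots> = poly (cycle_ehrhart d) (real n)"
    by (simp add: cycle_ehrhart_def poly_sum poly_prod algebra_simps del: binomial_Suc_Suc)
  finally show ?thesis .
qed

text \<open>Replacing x by -1 - x and the index i by D - i negates every linear factor, so each
  product of \<open>d\<close> factors acquires the sign (-1)^d.\<close>

lemma poly_cycle_ehrhart_reflect:
  "poly (cycle_ehrhart d) (- 1 - x) = (-1) ^ d * poly (cycle_ehrhart d) x"
proof -
  have "(\<Prod>i=1..d. real i - real k + (- 1 - x) * (real (Suc d) - 2 * real k)) =
     (-1) ^ d * (\<Prod>i=1..d. real i - real k + x * (real (Suc d) - 2 * real k))" for k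
  proof -
    have "(\<Prod>i=1..d. real i - real k + (- 1 - x) * (real (Suc d) - 2 * real k)) =
       (\<Prod>i=1..d. real (d + 1 - i) - real k + (- 1 - x) * (real (Suc d) - 2 * real k))"
      by (subst prod.atLeastAtMost_rev) simp
    also have "\<dots> = (\<Prod>i=1..d. (- 1) * (real i - real k + x * (real (Suc d) - 2 * real k)))"
      by (intro prod.cong refl) (auto simp: of_nat_diff algebra_simps)
    finally show ?thesis by (simp only: prod.distrib prod_constant card_atLeastAtMost) simp
  qed
  then show ?thesis
    by (simp add: cycle_ehrhart_def poly_sum poly_prod sum_distrib_left mult_ac
        del: binomial_Suc_Suc of_nat_Suc)
qed

section \<open>Lattice points in dilates of the polar dual\<close>

text \<open>This is the adjoint of \<open>forget_last\<close>. Functionals on the sum-zero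
  hyperplane are vertex functions modulo constants; the representative chosen here vanishes at
  \<open>None\<close>.\<close>

definition extend_zero :: "real ^ 'n::finite \<Rightarrow> 'n option \<Rightarrow> real" where
  "extend_zero y v = (case v of None \<Rightarrow> 0 | Some i \<Rightarrow> y $ i)"

lemma inner_forget_last: "forget_last u \<bullet> y = u \<bullet> (\<chi> v. extend_zero y v)"
  by (simp add: inner_vec_def forget_last_def extend_zero_def UNIV_option_conv sum.reindex)

text \<open>A half-space is convex, so it contains the hull as soon as it contains the generators.
  Edges are unordered, so the inequalities for the negated generators come from swapping
  \<open>v\<close> and \<open>w\<close>.\<close>

lemma mem_polar_dual_symmetric_edge_polytope:
  fixes E :: "'n::finite option set set"
  shows "y \<in> polar_dual (forget_last ` symmetric_edge_polytope E) \<longleftrightarrow>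
    (\<forall>v w. {v, w} \<in> E \<longrightarrow> extend_zero y v - extend_zero y w \<le> 1)"
proof -
  let ?Y = "\<chi> v. extend_zero y v"
  let ?V = "{axis v 1 - axis w 1 | v w. {v, w} \<in> E} \<union> {- (axis v 1 - axis w 1) | v w. {v, w} \<in> E}"
  have "convex {u. u \<bullet> ?Y \<le> 1}"
    using convex_halfspace_le[of ?Y 1] by (simp add: inner_commute)
  then have "convex hull ?V \<subseteq> {u. u \<bullet> ?Y \<le> 1} \<longleftrightarrow> ?V \<subseteq> {u. u \<bullet> ?Y \<le> 1}"
    by (rule subset_hull)
  moreover have "y \<in> polar_dual (forget_last ` symmetric_edge_polytope E) \<longleftrightarrow>
      convex hull ?V \<subseteq> {u. u \<bullet> ?Y \<le> 1}"
    by (auto simp: polar_dual_def symmetric_edge_polytope_def inner_forget_last)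
  moreover have "?V \<subseteq> {u. u \<bullet> ?Y \<le> 1} \<longleftrightarrow>
      (\<forall>v w. {v, w} \<in> E \<longrightarrow> (axis v 1 - axis w 1) \<bullet> ?Y \<le> 1 \<and> (axis w 1 - axis v 1) \<bullet> ?Y \<le> 1)"
    by (auto simp: minus_diff_eq)
  moreover have "(axis v 1 - axis w 1) \<bullet> ?Y = extend_zero y v - extend_zero y w" for v w
    by (simp add: inner_diff_left inner_axis')
  ultimately have iff: "y \<in> polar_dual (forget_last ` symmetric_edge_polytope E) \<longleftrightarrow>
      (\<forall>v w. {v, w} \<in> E \<longrightarrow>
        extend_zero y v - extend_zero y w \<le> 1 \<and> extend_zero y w - extend_zero y v \<le> 1)"
    by (simp only:)
  have "{v, w} \<in> E \<longleftrightarrow> {w, v} \<in> E" for v w by (simp only: insert_commute)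
  then show ?thesis unfolding iff by blast
qed

lemma mem_dilate_polar_dual:
  fixes E :: "'n::finite option set set"
  assumes "r > 0"
  shows "y \<in> (\<lambda>x. r *\<^sub>R x) ` polar_dual (forget_last ` symmetric_edge_polytope E) \<longleftrightarrow>
    (\<forall>v w. {v, w} \<in> E \<longrightarrow> extend_zero y v - extend_zero y w \<le> r)"
proof -
  have "y \<in> (\<lambda>x. r *\<^sub>R x) ` P \<longleftrightarrow> (1 / r) *\<^sub>R y \<in> P" for P
  proof
    assume "(1 / r) *\<^sub>R y \<in> P"
    then show "y \<in> (\<lambda>x. r *\<^sub>R x) ` P"
      using assms by (intro image_eqI[of _ _ "(1 / r) *\<^sub>R y"]) auto
  qed (use assms in auto)
  moreover have "extend_zero ((1 / r) *\<^sub>R y) v = extend_zero y v / r" for v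
    by (simp add: extend_zero_def split: option.split)
  ultimately show ?thesis
    using assms by (simp add: mem_polar_dual_symmetric_edge_polytope flip: diff_divide_distrib)
qed

lemma sum_cyclic_differences:
  "(\<Sum>i<Suc d. g (Suc i mod Suc d) - g i) = (0 :: 'a::ab_group_add)"
proof -
  have "(\<Sum>i<Suc d. g (Suc i mod Suc d)) = (\<Sum>i<d. g (Suc i)) + g 0"
    by simp
  also have "\<dots> = (\<Sum>i<Suc d. g i)"
    by (simp only: sum.lessThan_Suc_shift add.commute)
  finally show ?thesis by (simp only: sum_subtractf diff_self)
qed

text \<open>The bijection \<open>\<phi>\<close> records the differences along the cycle, shifted by
  \<open>n\<close> to make them natural numbers. Its inverse \<open>\<psi>\<close> rebuilds a point
  from partial sums.\<close>

lemma card_lattice_points_cycle: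
  fixes E :: "'n::finite option set set" and n :: nat
  assumes "cycle_graph E" and "n > 0"
  shows "card ((\<lambda>x. real n *\<^sub>R x) ` polar_dual (forget_last ` symmetric_edge_polytope E)
      \<inter> integer_points) =
    card {l \<in> natpermute (n * Suc CARD('n)) (Suc CARD('n)). \<forall>x\<in>set l. x \<le> 2 * n}"
    (is "card ?A = card ?B")
proof -
  let ?d = "CARD('n)"
  obtain c where c: "bij_betw c {..<Suc ?d} (UNIV :: 'n option set)"
    and E: "E = {{c i, c (Suc i mod Suc ?d)} | i. i < Suc ?d}"
    using assms(1) by (auto simp: cycle_graph_def)
  define c' where "c' = inv_into {..<Suc ?d} c"
  have c'_c: "c' (c i) = i" if "i < Suc ?d" for i
    using c that unfolding c'_def by (simp add: bij_betw_inv_into_left)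
  have c'_less: "c' v < Suc ?d" for v
    using bij_betw_inv_into[OF c] unfolding c'_def bij_betw_def by auto
  have c_c': "c (c' v) = v" for v
    using c unfolding c'_def by (simp add: bij_betw_inv_into_right)
  define \<delta> where "\<delta> y i = extend_zero y (c (Suc i mod Suc ?d)) - extend_zero y (c i)" for y i
  define \<phi> where "\<phi> y = map (\<lambda>i. nat \<lfloor>\<delta> y i + real n\<rfloor>) [0..<Suc ?d]" for y
  define S where "S l i = (\<Sum>j<i. real (l ! j) - real n)" for l :: "nat list" and i
  \<comment> \<open>The partial sums start from 0 at the vertex \<open>c 0\<close>, which may differ
    from \<open>None\<close>; subtracting the value at \<open>None\<close> restores the
    normalisation of \<open>extend_zero\<close>.\<close>
  define \<psi> where "\<psi> l = (\<chi> j. S l (c' (Some j)) - S l (c' None))" for l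
  have A: "\<bar>\<delta> y i\<bar> \<le> real n \<and> real (\<phi> y ! i) = \<delta> y i + real n"
    if y: "y \<in> ?A" and i: "i < Suc ?d" for y i
  proof -
    have "{c i, c (Suc i mod Suc ?d)} \<in> E" using i by (auto simp: E)
    moreover have "{c (Suc i mod Suc ?d), c i} \<in> E" using i by (auto simp: E insert_commute)
    ultimately have le: "\<bar>\<delta> y i\<bar> \<le> real n"
      using y assms(2) by (auto simp: mem_dilate_polar_dual \<delta>_def abs_le_iff)
    have "extend_zero y v \<in> \<int>" for v
      using y by (auto simp: integer_points_def extend_zero_def split: option.split)
    then have "\<delta> y i + real n \<in> \<int>" by (simp add: \<delta>_def)
    \<comment> \<open>The shifted difference is an integer in [0, 2n], so neither
      \<open>floor\<close> nor \<open>nat\<close> changes it.\<close>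
    then have "real (nat \<lfloor>\<delta> y i + real n\<rfloor>) = \<delta> y i + real n"
      using le by (auto elim!: Ints_cases)
    moreover have "\<phi> y ! i = nat \<lfloor>\<delta> y i + real n\<rfloor>"
      using i by (simp add: \<phi>_def del: upt_Suc)
    ultimately show ?thesis using le by simp
  qed
  have S_\<phi>: "S (\<phi> y) i = extend_zero y (c i) - extend_zero y (c 0)"
    if y: "y \<in> ?A" and i: "i < Suc ?d" for y i
    using i
  proof (induction i)
    case (Suc i)
    then show ?case using A[OF y, of i] by (simp add: S_def \<delta>_def)
  qed (simp add: S_def)
  have \<psi>_\<phi>: "\<psi> (\<phi> y) = y" if "y \<in> ?A" for y
    using S_\<phi>[OF that c'_less]
    by (simp add: \<psi>_def c_c' vec_eq_iff) (simp add: extend_zero_def)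
  have \<phi>_mem: "\<phi> y \<in> ?B" if y: "y \<in> ?A" for y
  proof -
    have len: "length (\<phi> y) = Suc ?d" by (simp add: \<phi>_def)
    have "real (sum_list (\<phi> y)) = (\<Sum>i<Suc ?d. real (\<phi> y ! i))"
      unfolding sum_list_sum_nth len atLeast0LessThan by (rule of_nat_sum)
    also have "\<dots> = (\<Sum>i<Suc ?d. \<delta> y i + real n)" using A[OF y] by (intro sum.cong) auto
    also have "\<dots> = real (n * Suc ?d)"
      using sum_cyclic_differences[of "\<lambda>i. extend_zero y (c i)" ?d]
      unfolding sum.distrib \<delta>_def by (simp add: algebra_simps)
    finally have "sum_list (\<phi> y) = n * Suc ?d" by (simp only: of_nat_eq_iff)
    moreover have "\<phi> y ! i \<le> 2 * n" if "i < Suc ?d" for i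
      using A[OF y that] by (simp add: abs_le_iff)
    ultimately show ?thesis
      using len by (auto simp: natpermute_def in_set_conv_nth)
  qed
  have \<delta>_\<psi>: "\<delta> (\<psi> l) i = real (l ! i) - real n" if l: "l \<in> ?B" and i: "i < Suc ?d" for l i
  proof -
    have len: "length l = Suc ?d" and sum: "sum_list l = n * Suc ?d"
      using l by (auto simp: natpermute_def)
    have "real (sum_list l) = (\<Sum>i<Suc ?d. real (l ! i))"
      unfolding sum_list_sum_nth len atLeast0LessThan by (rule of_nat_sum)
    then have "S l (Suc ?d) = real (sum_list l) - real (n * Suc ?d)"
      unfolding S_def sum_subtractf by (simp add: algebra_simps)
    then have S0: "S l (Suc ?d) = 0" by (simp only: sum diff_self)
    have "extend_zero (\<psi> l) v = S l (c' v) - S l (c' None)" for v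
      by (simp add: extend_zero_def \<psi>_def split: option.split)
    then have ez: "extend_zero (\<psi> l) (c j) = S l j - S l (c' None)" if "j < Suc ?d" for j
      using c'_c[OF that] by simp
    \<comment> \<open>Sum zero is what closes the cycle: the partial sum after the last edge returns
      to the value 0 at the start.\<close>
    have "S l (Suc i mod Suc ?d) = S l (Suc i)"
    proof (cases "i = ?d")
      case True
      then show ?thesis using S0 by (simp add: S_def)
    qed (use i in simp)
    then have "\<delta> (\<psi> l) i = S l (Suc i) - S l i"
      unfolding \<delta>_def using ez i by simp
    then show ?thesis by (simp add: S_def)
  qed
  have \<phi>_\<psi>: "\<phi> (\<psi> l) = l" if l: "l \<in> ?B" for l
  proof (rule nth_equalityI)
    show len: "length (\<phi> (\<psi> l)) = length l" using l by (simp add: \<phi>_def natpermute_def)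
    fix i assume "i < length (\<phi> (\<psi> l))"
    then have i: "i < Suc ?d" by (simp add: \<phi>_def)
    have "\<delta> (\<psi> l) i + real n = real (l ! i)" using \<delta>_\<psi>[OF l i] by simp
    moreover have "\<phi> (\<psi> l) ! i = nat \<lfloor>\<delta> (\<psi> l) i + real n\<rfloor>"
      using i by (simp add: \<phi>_def del: upt_Suc)
    ultimately show "\<phi> (\<psi> l) ! i = l ! i" by (simp only: floor_of_nat nat_int)
  qed
  have \<psi>_mem: "\<psi> l \<in> ?A" if l: "l \<in> ?B" for l
  proof -
    have \<delta>_le: "\<bar>\<delta> (\<psi> l) i\<bar> \<le> real n" if "i < Suc ?d" for i
    proof -
      have "l ! i \<le> 2 * n" using l that by (auto simp: natpermute_def)
      then show ?thesis using \<delta>_\<psi>[OF l that] by (simp add: abs_le_iff)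
    qed
    have "extend_zero (\<psi> l) v - extend_zero (\<psi> l) w \<le> real n" if "{v, w} \<in> E" for v w
    proof -
      have "\<exists>i. {v, w} = {c i, c (Suc i mod Suc ?d)} \<and> i < Suc ?d"
        using that unfolding E mem_Collect_eq .
      then obtain i where "i < Suc ?d" "{v, w} = {c i, c (Suc i mod Suc ?d)}"
        by (elim exE conjE)
      then show ?thesis using \<delta>_le[of i] by (auto simp: doubleton_eq_iff \<delta>_def abs_le_iff)
    qed
    moreover have "\<psi> l \<in> integer_points"
      by (auto simp: integer_points_def \<psi>_def S_def intro!: Ints_diff Ints_sum)
    ultimately show ?thesis using assms(2) by (simp add: mem_dilate_polar_dual)
  qed
  have "bij_betw \<phi> ?A ?B"
    using \<psi>_\<phi> \<phi>_\<psi> \<phi>_mem \<psi>_mem by (intro bij_betw_byWitness[of _ \<psi>]) blast+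
  then show ?thesis by (rule bij_betw_same_card)
qed

lemma ehrhart_polynomial_polar_dual_cycle:
  fixes E :: "'n::finite option set set"
  assumes "cycle_graph E"
  shows "ehrhart_polynomial (polar_dual (forget_last ` symmetric_edge_polytope E)) =
    cycle_ehrhart CARD('n)"
  by (rule ehrhart_polynomial_eqI)
     (simp only: card_lattice_points_cycle[OF assms] card_bounded_natpermute_eq_poly)

section \<open>The three lowest coefficients of the Ehrhart polynomial\<close>

text \<open>Factoring out all \<open>b i\<close> leaves the product of 1 + c * x / b i, whose
  coefficients are elementary symmetric in the 1 / b i. The second one is written through power sums
  by Newton's identity.\<close>

lemma coeff_prod_linear:
  fixes b :: "'i \<Rightarrow> 'a::field_char_0"
  assumes "finite I" and "\<And>i. i \<in> I \<Longrightarrow> b i \<noteq> 0"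
  shows "coeff (\<Prod>i\<in>I. [:b i, c:]) 0 = (\<Prod>i\<in>I. b i)"
    and "coeff (\<Prod>i\<in>I. [:b i, c:]) (Suc 0) = (\<Prod>i\<in>I. b i) * (c * (\<Sum>i\<in>I. 1 / b i))"
    and "coeff (\<Prod>i\<in>I. [:b i, c:]) (Suc (Suc 0)) =
      (\<Prod>i\<in>I. b i) * (c\<^sup>2 * ((\<Sum>i\<in>I. 1 / b i)\<^sup>2 - (\<Sum>i\<in>I. 1 / (b i)\<^sup>2)) / 2)"
proof -
  let ?p = "\<lambda>I. \<Prod>i\<in>I. [:b i, c:]" and ?P = "\<lambda>I. \<Prod>i\<in>I. b i"
    and ?s = "\<lambda>I. \<Sum>i\<in>I. 1 / b i" and ?t = "\<lambda>I. \<Sum>i\<in>I. 1 / (b i)\<^sup>2"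
  have "coeff (?p I) 0 = ?P I \<and> coeff (?p I) (Suc 0) = ?P I * (c * ?s I) \<and>
      coeff (?p I) (Suc (Suc 0)) = ?P I * (c\<^sup>2 * ((?s I)\<^sup>2 - ?t I) / 2)"
    using assms
  proof (induction I rule: finite_induct)
    case (insert j I)
    then have b: "b j \<noteq> 0"
      and IH: "coeff (?p I) 0 = ?P I" "coeff (?p I) (Suc 0) = ?P I * (c * ?s I)"
        "coeff (?p I) (Suc (Suc 0)) = ?P I * (c\<^sup>2 * ((?s I)\<^sup>2 - ?t I) / 2)"
      by auto
    have insert_eqs: "?p (insert j I) = [:b j, c:] * ?p I" "?P (insert j I) = b j * ?P I"
      "?s (insert j I) = 1 / b j + ?s I" "?t (insert j I) = 1 / (b j)\<^sup>2 + ?t I"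
      using insert.hyps by simp_all
    have coeff_mult: "coeff ([:b j, c:] * q) 0 = b j * coeff q 0"
      "coeff ([:b j, c:] * q) (Suc m) = b j * coeff q (Suc m) + c * coeff q m" for q m
      by simp_all
    have "b j * (P * (c * s)) + c * P = b j * P * (c * (1 / b j + s))" for P s
      using b by (simp add: field_simps)
    moreover have "b j * (P * (c\<^sup>2 * (s\<^sup>2 - t) / 2)) + c * (P * (c * s)) =
        b j * P * (c\<^sup>2 * ((1 / b j + s)\<^sup>2 - (1 / (b j)\<^sup>2 + t)) / 2)" for P s t
      using b by (simp add: field_simps power2_eq_square)
    ultimately show ?case by (simp only: insert_eqs coeff_mult IH)
  qed simp
  then show "coeff (?p I) 0 = ?P I" "coeff (?p I) (Suc 0) = ?P I * (c * ?s I)"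
    "coeff (?p I) (Suc (Suc 0)) = ?P I * (c\<^sup>2 * ((?s I)\<^sup>2 - ?t I) / 2)"
    by blast+
qed

text \<open>Splits the indices by their distance to \<open>k\<close> on either side. The abstract
  setting makes it available for both the product and the sum needed below.\<close>

lemma (in comm_monoid_set) punctured_interval:
  fixes k d :: nat
  assumes "k \<in> {1..d}"
  shows "F g ({1..d} - {k}) = F (\<lambda>j. g (k - j)) {1..k - 1} \<^bold>* F (\<lambda>j. g (k + j)) {1..d - k}"
proof -
  have "{1..d} - {k} = {1..k - 1} \<union> {k + 1..d}" using assms by auto
  then have "F g ({1..d} - {k}) = F g {1..k - 1} \<^bold>* F g {k + 1..d}"
    by (simp add: union_disjoint)
  moreover have "F g {1..k - 1} = F (\<lambda>j. g (k - j)) {1..k - 1}"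
    by (rule reindex_bij_witness[of _ "\<lambda>j. k - j" "\<lambda>j. k - j"]) auto
  moreover have "F g {k + 1..d} = F (\<lambda>j. g (k + j)) {1..d - k}"
    by (rule reindex_bij_witness[of _ "\<lambda>j. k + j" "\<lambda>j. j - k"]) auto
  ultimately show ?thesis by simp
qed

definition harm2 :: "nat \<Rightarrow> real" where
  "harm2 n = (\<Sum>i=1..n. 1 / (real i)\<^sup>2)"

lemma harm2_0: "harm2 0 = 0" and harm2_Suc: "harm2 (Suc n) = harm2 n + 1 / (real (Suc n))\<^sup>2"
  by (simp_all add: harm2_def)

lemma harm_eq_sum: "harm n = (\<Sum>i=1..n. 1 / real i)"
  by (simp add: harm_def inverse_eq_divide)

lemma coeff_cycle_ehrhart_term_0:
  fixes d :: nat
  defines "T \<equiv> smult (1 / fact d) (\<Prod>i=1..d. [:real i, real (Suc d):])"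
  shows "coeff T 0 = 1" and "coeff T (Suc 0) = real (Suc d) * harm d"
    and "coeff T (Suc (Suc 0)) = (real (Suc d))\<^sup>2 * ((harm d)\<^sup>2 - harm2 d) / 2"
proof -
  show "coeff T 0 = 1"
    unfolding T_def coeff_smult by (subst coeff_prod_linear) (auto simp: fact_prod)
  show "coeff T (Suc 0) = real (Suc d) * harm d"
    unfolding T_def coeff_smult harm_eq_sum by (subst coeff_prod_linear) (auto simp: fact_prod)
  show "coeff T (Suc (Suc 0)) = (real (Suc d))\<^sup>2 * ((harm d)\<^sup>2 - harm2 d) / 2"
    unfolding T_def coeff_smult harm_eq_sum harm2_def
    by (subst coeff_prod_linear) (auto simp: fact_prod)
qed

text \<open>The factor with i = k has no constant term and only shifts the coefficients by one.
  Hence just the two lowest coefficients of the remaining product are needed, and their constants i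
  - k are nonzero.\<close>

lemma coeff_cycle_ehrhart_term:
  fixes d k :: nat
  assumes k: "k \<in> {1..d}"
  defines "T \<equiv> smult ((-1) ^ k * real (Suc d choose k) / fact d)
     (\<Prod>i=1..d. [:real i - real k, real (Suc d) - 2 * real k:])"
  shows "coeff T 0 = 0"
    and "coeff T (Suc 0) = - real (Suc d) * (1 / real k - 1 / real (Suc d - k))"
    and "coeff T (Suc (Suc 0)) = - real (Suc d) *
      ((real (Suc d) - 2 * real k)\<^sup>2 / (real k * real (Suc d - k)) * (harm (d - k) - harm (k - 1)))"
proof -
  let ?c = "real (Suc d) - 2 * real k" and ?I = "{1..d} - {k}"
  let ?w = "(-1) ^ k * real (Suc d choose k) / fact d"
  let ?q = "\<Prod>i\<in>?I. [:real i - real k, ?c:]"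
  have T: "T = smult ?w ([:0, ?c:] * ?q)"
    unfolding T_def using k by (subst prod.remove[of _ k]) auto
  have prod: "(\<Prod>i\<in>?I. real i - real k) = (-1) ^ (k - 1) * fact (k - 1) * fact (d - k)"
  proof -
    have "(\<Prod>j=1..k - 1. real (k - j) - real k) = (\<Prod>j=1..k - 1. (-1) * real j)"
      by (intro prod.cong) (auto simp: of_nat_diff)
    also have "\<dots> = (-1) ^ (k - 1) * fact (k - 1)"
      unfolding prod.distrib by (simp add: fact_prod)
    finally show ?thesis
      using k by (subst prod.punctured_interval) (simp_all add: fact_prod)
  qed
  have sum: "(\<Sum>i\<in>?I. 1 / (real i - real k)) = harm (d - k) - harm (k - 1)"
  proof -
    have "(\<Sum>j=1..k - 1. 1 / (real (k - j) - real k)) = (\<Sum>j=1..k - 1. - (1 / real j))"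
      by (intro sum.cong) (auto simp: of_nat_diff)
    also have "\<dots> = - harm (k - 1)"
      unfolding sum_negf harm_eq_sum ..
    finally show ?thesis
      using k by (subst sum.punctured_interval) (simp_all add: harm_eq_sum)
  qed
  \<comment> \<open>The signs multiply to -1, and D! / (k! * (D - k)!) cancels the factorials up to
    D / (k * (D - k)).\<close>
  have weight: "?w * ((-1) ^ (k - 1) * fact (k - 1) * fact (d - k)) =
      - real (Suc d) / (real k * real (Suc d - k))"
  proof -
    obtain j where j: "k = Suc j" using k by (cases k) auto
    obtain e where e: "d = k + e" using k by (metis atLeastAtMost_iff le_Suc_ex)
    have "real (Suc d choose k) = fact (Suc d) / (fact k * fact (Suc e))"
      using e by (subst binomial_fact) (auto simp: Suc_diff_le)
    moreover have "((-1::real) ^ k) * (-1) ^ j = - 1"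
      by (simp add: j flip: power_mult_distrib)
    ultimately show ?thesis
      by (simp add: j e Suc_diff_le field_simps del: of_nat_Suc)
  qed
  have nz: "finite ?I" "\<And>i. i \<in> ?I \<Longrightarrow> real i - real k \<noteq> 0" by auto
  have q: "coeff ?q 0 = (-1) ^ (k - 1) * fact (k - 1) * fact (d - k)"
    "coeff ?q (Suc 0) = (-1) ^ (k - 1) * fact (k - 1) * fact (d - k) *
      (?c * (harm (d - k) - harm (k - 1)))"
    by (simp_all only: coeff_prod_linear[OF nz] prod sum)
  have coeff_Suc: "coeff T (Suc j) = ?w * (?c * coeff ?q j)" for j
    unfolding T coeff_smult by (simp del: binomial_Suc_Suc)
  show "coeff T 0 = 0" by (simp add: T)
  have Dk: "real (Suc d - k) = real (Suc d) - real k" "real k > 0" "real (Suc d) - real k > 0"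
    using k by (auto simp: of_nat_diff)
  have "coeff T (Suc 0) = ?c * (?w * ((-1) ^ (k - 1) * fact (k - 1) * fact (d - k)))"
    unfolding coeff_Suc q by (simp only: mult_ac)
  \<comment> \<open>Partial fractions: (D - 2 * k) / (k * (D - k)) = 1 / k - 1 / (D - k).\<close>
  then show "coeff T (Suc 0) = - real (Suc d) * (1 / real k - 1 / real (Suc d - k))"
    unfolding weight using Dk by (simp add: field_simps del: of_nat_Suc)
  have "coeff T (Suc (Suc 0)) = ?c\<^sup>2 * (?w * ((-1) ^ (k - 1) * fact (k - 1) * fact (d - k))) *
      (harm (d - k) - harm (k - 1))"
    unfolding coeff_Suc q power2_eq_square by (simp only: mult_ac)
  then show "coeff T (Suc (Suc 0)) = - real (Suc d) *
      (?c\<^sup>2 / (real k * real (Suc d - k)) * (harm (d - k) - harm (k - 1)))"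
    unfolding weight by (simp add: mult_ac)
qed

lemma sum_inverse_diff:
  assumes "m \<le> d"
  shows "(\<Sum>k=1..m. 1 / real k - 1 / real (Suc d - k)) = harm m + harm (d - m) - harm d"
  using assms
proof (induction m)
  case 0
  then show ?case by (simp add: harm_expand)
next
  case (Suc m)
  then obtain e where "d = m + Suc e" by (metis Suc_le_eq less_imp_Suc_add add_Suc_right)
  with Suc show ?case by (simp add: harm_Suc inverse_eq_divide)
qed

text \<open>With \<open>v m = harm (d - m) - harm m\<close>, the terms telescope because
  \<open>v (k - 1) - v k = 1 / k + 1 / (D - k)\<close> for \<open>D = d + 1\<close>, while
  \<open>(D - 2 * k)\<^sup>2 / (k * (D - k)) = D * (1 / k + 1 / (D - k)) - 4\<close>.\<close>

lemma sum_quadratic_term: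
  assumes "m \<le> d"
  shows "(\<Sum>k=1..m. (real (Suc d) - 2 * real k)\<^sup>2 / (real k * real (Suc d - k)) *
      (harm (d - k) - harm (k - 1))) =
    real (Suc d) / 2 * ((harm d)\<^sup>2 - (harm (d - m) - harm m)\<^sup>2 + harm2 m - harm2 d + harm2 (d - m))
    - 4 * (real d * harm d - real (d - m) * harm (d - m) - real m * harm m)"
  using assms
proof (induction m)
  case 0
  then show ?case by (simp add: harm_expand harm2_0)
next
  case (Suc m)
  then obtain e where d: "d = m + Suc e" by (metis Suc_le_eq less_imp_Suc_add add_Suc_right)
  \<comment> \<open>For the new index k = m + 1 these are k and D - k.\<close>
  define x y where "x = real (Suc m)" and "y = real (Suc e)"
  have xy: "x > 0" "y > 0" by (simp_all add: x_def y_def)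
  define A B :: real where "A = harm e" and "B = harm m"
  have eqs: "real (Suc d) = x + y" "harm (d - m) = A + 1 / y" "harm (d - Suc m) = A"
    "harm (Suc m) = B + 1 / x" "harm m = B" "real (d - m) = y" "real (d - Suc m) = y - 1"
    "real m = x - 1" "real (Suc m) = x" "real (Suc d - Suc m) = y"
    "harm2 (d - m) = harm2 e + 1 / y\<^sup>2" "harm2 (d - Suc m) = harm2 e"
    "harm2 (Suc m) = harm2 m + 1 / x\<^sup>2" "harm (Suc m - 1) = B"
    by (simp_all add: d x_def y_def A_def B_def harm_Suc harm2_Suc inverse_eq_divide)
  \<comment> \<open>The two squares differ by 2 * (A - B) * (1 / x + 1 / y) + 1 / y^2 - 1 / x^2. The
    reciprocal squares are compensated here, which is the origin of the \<open>harm2\<close> terms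
    in the closed form.\<close>
  have step: "(x + y - 2 * x)\<^sup>2 / (x * y) * (A - B) =
    (x + y) / 2 * ((A + 1 / y - B)\<^sup>2 - (A - (B + 1 / x))\<^sup>2 + 1 / x\<^sup>2 - 1 / y\<^sup>2) - 4 * (A - B)"
    using xy by (simp add: field_simps power2_eq_square)
  have IH: "(\<Sum>k=1..m. (real (Suc d) - 2 * real k)\<^sup>2 / (real k * real (Suc d - k)) *
      (harm (d - k) - harm (k - 1))) =
    (x + y) / 2 * ((harm d)\<^sup>2 - (A + 1 / y - B)\<^sup>2 + harm2 m - harm2 d + (harm2 e + 1 / y\<^sup>2))
    - 4 * (real d * harm d - y * (A + 1 / y) - (x - 1) * B)"
    using Suc by (simp only: eqs)
  have "(\<Sum>k=1..Suc m. (real (Suc d) - 2 * real k)\<^sup>2 / (real k * real (Suc d - k)) *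
      (harm (d - k) - harm (k - 1))) =
    (\<Sum>k=1..m. (real (Suc d) - 2 * real k)\<^sup>2 / (real k * real (Suc d - k)) *
      (harm (d - k) - harm (k - 1))) + (x + y - 2 * x)\<^sup>2 / (x * y) * (A - B)"
    by (subst sum.cl_ivl_Suc) (simp only: eqs, simp)
  also have "\<dots> = (x + y) / 2 *
      ((harm d)\<^sup>2 - (A - (B + 1 / x))\<^sup>2 + (harm2 m + 1 / x\<^sup>2) - harm2 d + harm2 e)
    - 4 * (real d * harm d - (y - 1) * A - x * (B + 1 / x))"
    unfolding IH step using xy by (simp add: algebra_simps)
  finally show ?case by (simp only: eqs)
qed

text \<open>In the quadratic coefficient, the square of \<open>harm d\<close> and
  \<open>harm2 d\<close> from the term k = 0 cancel against the sum over the other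
  \<open>k\<close>.\<close>

lemma coeff_cycle_ehrhart:
  fixes d :: nat
  defines "D \<equiv> real (Suc d)" and "f \<equiv> d div 2"
  shows "coeff (cycle_ehrhart d) 0 = 1"
    and "coeff (cycle_ehrhart d) (Suc 0) = D * (2 * harm d - harm f - harm (d - f))"
    and "coeff (cycle_ehrhart d) (Suc (Suc 0)) =
      D\<^sup>2 / 2 * ((harm (d - f) - harm f)\<^sup>2 - harm2 f - harm2 (d - f))
      + 4 * D * (real d * harm d - real (d - f) * harm (d - f) - real f * harm f)"
proof -
  let ?T = "\<lambda>k. smult ((-1) ^ k * real (Suc d choose k) / fact d)
     (\<Prod>i=1..d. [:real i - real k, real (Suc d) - 2 * real k:])"
  let ?U = "smult (1 / fact d) (\<Prod>i=1..d. [:real i, real (Suc d):])"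
  have "cycle_ehrhart d = ?T 0 + (\<Sum>k=1..f. ?T k)"
    unfolding cycle_ehrhart_def f_def[symmetric] atMost_atLeast0
    by (subst sum.atLeast_Suc_atMost) simp_all
  moreover have "?T 0 = ?U" by simp
  ultimately have coeff: "coeff (cycle_ehrhart d) j = coeff ?U j + (\<Sum>k=1..f. coeff (?T k) j)" for j
    by (simp only: coeff_add coeff_sum)
  have f_sub: "k \<in> {1..d}" if "k \<in> {1..f}" for k
    using that by (auto simp: f_def)
  have f: "f \<le> d" by (simp add: f_def)
  have "(\<Sum>k=1..f. coeff (?T k) 0) = 0"
    using coeff_cycle_ehrhart_term(1)[OF f_sub] by (intro sum.neutral) blast
  then show "coeff (cycle_ehrhart d) 0 = 1"
    unfolding coeff by (simp only: coeff_cycle_ehrhart_term_0)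
  have "(\<Sum>k=1..f. coeff (?T k) (Suc 0)) = (\<Sum>k=1..f. - D * (1 / real k - 1 / real (Suc d - k)))"
    unfolding D_def using coeff_cycle_ehrhart_term(2)[OF f_sub] by (intro sum.cong refl) blast
  also have "\<dots> = - D * (harm f + harm (d - f) - harm d)"
    by (simp only: sum_distrib_left[symmetric] sum_inverse_diff[OF f])
  finally have sum1: "(\<Sum>k=1..f. coeff (?T k) (Suc 0)) = \<dots>" .
  show "coeff (cycle_ehrhart d) (Suc 0) = D * (2 * harm d - harm f - harm (d - f))"
    unfolding coeff sum1 coeff_cycle_ehrhart_term_0 D_def by (simp add: algebra_simps)
  have "(\<Sum>k=1..f. coeff (?T k) (Suc (Suc 0))) =
      (\<Sum>k=1..f. - D * ((real (Suc d) - 2 * real k)\<^sup>2 / (real k * real (Suc d - k)) *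
        (harm (d - k) - harm (k - 1))))"
    unfolding D_def using coeff_cycle_ehrhart_term(3)[OF f_sub] by (intro sum.cong refl) blast
  also have "\<dots> = - D * (D / 2 * ((harm d)\<^sup>2 - (harm (d - f) - harm f)\<^sup>2
        + harm2 f - harm2 d + harm2 (d - f))
      - 4 * (real d * harm d - real (d - f) * harm (d - f) - real f * harm f))"
    by (simp only: sum_distrib_left[symmetric] sum_quadratic_term[OF f] D_def)
  finally have sum2: "(\<Sum>k=1..f. coeff (?T k) (Suc (Suc 0))) = \<dots>" .
  show "coeff (cycle_ehrhart d) (Suc (Suc 0)) =
      D\<^sup>2 / 2 * ((harm (d - f) - harm f)\<^sup>2 - harm2 f - harm2 (d - f))
      + 4 * D * (real d * harm d - real (d - f) * harm (d - f) - real f * harm f)"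
    unfolding coeff sum2 coeff_cycle_ehrhart_term_0 unfolding D_def[symmetric]
    by (simp add: field_simps power2_eq_square)
qed

section \<open>Inequalities between harmonic sums\<close>

text \<open>Each of the d - m reciprocals on the right is at least 1 / d.\<close>

lemma harm_diff_ge:
  assumes "m \<le> d"
  shows "(real d - real m) / real d \<le> harm d - harm m"
  using assms
proof (induction d rule: dec_induct)
  case (step n)
  have "(real (Suc n) - real m) / real (Suc n) = (real n - real m) / real (Suc n) + 1 / real (Suc n)"
    by (simp add: field_simps)
  also have "(real n - real m) / real (Suc n) \<le> (real n - real m) / real n"
    using step.hyps by (cases "n = 0") (auto intro: divide_left_mono)
  finally show ?case using step.IH by (simp add: harm_Suc inverse_eq_divide)
qed simp

text \<open>For d = 2 * f this is the inequality a 2 > 0 divided by D^2: the left side is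
  \<open>harm2 f - L\<close> and the right side is d * (d - 1) / 2 over D^2.\<close>

lemma harm2_bound_even:
  assumes "f \<ge> 1"
  shows "harm2 f - 2 * (harm (2 * f) - harm f) <
    real f * (2 * real f - 1) / (2 * real f + 1)\<^sup>2"
  using assms
proof (induction f rule: nat_induct_at_least)
  case base
  then show ?case by (simp add: harm_expand harm2_def numeral_2_eq_2 harm_Suc)
next
  case (Suc f)
  define x where "x = real f"
  have x: "x \<ge> 1" using Suc.hyps by (simp add: x_def)
  have "2 * Suc f = Suc (Suc (2 * f))" by simp
  then have "harm2 (Suc f) - 2 * (harm (2 * Suc f) - harm (Suc f)) =
    harm2 f - 2 * (harm (2 * f) - harm f) +
      (1 / (x + 1)\<^sup>2 - 2 * (1 / (2 * x + 1) + 1 / (2 * x + 2) - 1 / (x + 1)))"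
    by (simp only: harm_Suc harm2_Suc) (simp add: x_def inverse_eq_divide algebra_simps)
  also have "\<dots> < x * (2 * x - 1) / (2 * x + 1)\<^sup>2 +
      (1 / (x + 1)\<^sup>2 - 2 * (1 / (2 * x + 1) + 1 / (2 * x + 2) - 1 / (x + 1)))"
    using Suc.IH by (simp add: x_def)
  also have "\<dots> \<le> (x + 1) * (2 * x + 1) / (2 * x + 3)\<^sup>2"
  proof -
    have "2 * x + 2 = 2 * (x + 1)" by simp
    \<comment> \<open>The excess of the right side's increment over the left side's; its numerator
      has only positive coefficients.\<close>
    then have "(x + 1) * (2 * x + 1) / (2 * x + 3)\<^sup>2 - (x * (2 * x - 1) / (2 * x + 1)\<^sup>2 +
      (1 / (x + 1)\<^sup>2 - 2 * (1 / (2 * x + 1) + 1 / (2 * x + 2) - 1 / (x + 1)))) =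
      (4 * x ^ 4 + 12 * x ^ 3 + 15 * x\<^sup>2 + 9 * x + 1) /
      ((2 * x + 3)\<^sup>2 * (2 * x + 1)\<^sup>2 * (x + 1)\<^sup>2)"
      using x by (simp only:) (simp add: divide_simps; algebra)
    also have "\<dots> \<ge> 0" using x by (intro divide_nonneg_nonneg) auto
    finally show ?thesis by simp
  qed
  finally show ?case by (simp add: x_def algebra_simps)
qed

text \<open>The analogue for d = 2 * f + 1, where the numerator on the right is d * (d - 1) / 2 - 4
  and D^2 = 4 * (f + 1)^2.\<close>

lemma harm2_bound_odd:
  assumes "f \<ge> 1"
  shows "harm2 f - (2 * harm (Suc (2 * f)) - harm f - harm (Suc f)) <
    (2 * (real f)\<^sup>2 + real f - 4) / (4 * (real f + 1)\<^sup>2)"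
  using assms
proof (induction f rule: nat_induct_at_least)
  case base
  then show ?case by (simp add: harm_expand harm2_def numeral_2_eq_2 harm_Suc)
next
  case (Suc f)
  define x where "x = real f"
  have x: "x \<ge> 1" using Suc.hyps by (simp add: x_def)
  have "2 * Suc f = Suc (Suc (2 * f))" by simp
  then have "harm2 (Suc f) - (2 * harm (Suc (2 * Suc f)) - harm (Suc f) - harm (Suc (Suc f))) =
    harm2 f - (2 * harm (Suc (2 * f)) - harm f - harm (Suc f)) +
      (1 / (x + 1)\<^sup>2 - 2 / (2 * x + 2) - 2 / (2 * x + 3) + 1 / (x + 1) + 1 / (x + 2))"
    by (simp only: harm_Suc harm2_Suc) (simp add: x_def inverse_eq_divide algebra_simps)
  also have "\<dots> < (2 * x\<^sup>2 + x - 4) / (4 * (x + 1)\<^sup>2) +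
      (1 / (x + 1)\<^sup>2 - 2 / (2 * x + 2) - 2 / (2 * x + 3) + 1 / (x + 1) + 1 / (x + 2))"
    using Suc.IH by (simp add: x_def)
  also have "\<dots> \<le> (2 * (x + 1)\<^sup>2 + (x + 1) - 4) / (4 * (x + 2)\<^sup>2)"
  proof -
    have "2 * x + 2 = 2 * (x + 1)" by simp
    then have "(2 * (x + 1)\<^sup>2 + (x + 1) - 4) / (4 * (x + 2)\<^sup>2) - ((2 * x\<^sup>2 + x - 4) / (4 * (x + 1)\<^sup>2) +
      (1 / (x + 1)\<^sup>2 - 2 / (2 * x + 2) - 2 / (2 * x + 3) + 1 / (x + 1) + 1 / (x + 2))) =
      (2 * x ^ 3 + 11 * x\<^sup>2 + 15 * x + 5) /
      (4 * (x + 2)\<^sup>2 * (x + 1)\<^sup>2 * (2 * x + 3))"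
      using x by (simp only:) (simp add: divide_simps; algebra)
    also have "\<dots> \<ge> 0" using x by (intro divide_nonneg_nonneg) auto
    finally show ?thesis by simp
  qed
  finally show ?case by (simp add: x_def algebra_simps)
qed

section \<open>Positivity of the expansion coefficients\<close>

text \<open>The summand of index \<open>j\<close> starts at x^j, so the system is triangular and can
  be solved for \<open>a\<close> from the bottom.\<close>

lemma coeff_expansion:
  fixes p :: "'a::{idom, ring_char_0} poly"
  assumes p: "\<And>x. poly p x = (\<Sum>j\<le>d. a j * x ^ j * (1 + x) ^ (d - j))" and "i \<le> d"
  shows "coeff p i = (\<Sum>j\<le>i. a j * of_nat ((d - j) choose (i - j)))"
proof -
  have "p = (\<Sum>j\<le>d. smult (a j) (monom 1 j * [:1, 1:] ^ (d - j)))"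
    by (intro poly_eq_poly_eq_iff[THEN iffD1] ext) (simp add: p poly_sum poly_monom mult.assoc)
  then have "coeff p i = (\<Sum>j\<le>d. if j \<le> i then a j * of_nat ((d - j) choose (i - j)) else 0)"
    using assms(2)
    by (auto simp: coeff_sum coeff_monom_mult coeff_linear_poly_power diff_le_mono intro!: sum.cong)
  also have "\<dots> = (\<Sum>j\<le>i. if j \<le> i then a j * of_nat ((d - j) choose (i - j)) else 0)"
    using assms(2) by (intro sum.mono_neutral_right) auto
  finally show ?thesis by simp
qed

text \<open>Stated for any sequence satisfying the expansion, so that it applies to \<open>a\<close>
  and to its reversal alike.\<close>

lemma cycle_ehrhart_expansion_pos:
  fixes a :: "nat \<Rightarrow> real"
  assumes "d \<ge> 2"
    and "\<And>x. poly (cycle_ehrhart d) x = (\<Sum>j\<le>d. a j * x ^ j * (1 + x) ^ (d - j))"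
  shows "a 0 > 0" and "a 1 > 0" and "a 2 > 0"
proof -
  define f L where "f = d div 2" and "L = 2 * harm d - harm f - (harm (d - f) :: real)"
  define D where "D = real (Suc d)"
  have D: "D > 0" "real d = D - 1" by (simp_all add: D_def)
  have f: "f \<ge> 1" "f \<le> d" using assms(1) by (auto simp: f_def)
  note coeffs = coeff_cycle_ehrhart[of d, folded f_def D_def L_def]
  have choose_two: "real (n choose 2) = real n * (real n - 1) / 2" for n
    by (induction n) (simp_all add: numeral_2_eq_2 field_simps)
  have a0: "a 0 = 1"
    using coeff_expansion[OF assms(2), of 0] coeffs(1) by simp
  have a1: "a 1 = D * L - real d"
    using coeff_expansion[OF assms(2), of 1] coeffs(2) assms(1) a0 by (simp add: L_def)
  have "coeff (cycle_ehrhart d) 2 = real (d choose 2) + a 1 * real (d - 1) + a 2"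
    using coeff_expansion[OF assms(2), of 2] assms(1) a0
    by (simp add: numeral_2_eq_2 del: binomial_Suc_Suc)
  then have a2: "a 2 = coeff (cycle_ehrhart d) (Suc (Suc 0)) - real d * (real d - 1) / 2
      - (D * L - real d) * (real d - 1)"
    unfolding choose_two a1 Suc_1[unfolded One_nat_def] using assms(1) by (simp add: of_nat_diff)
  show "a 0 > 0" by (simp add: a0)
  \<comment> \<open>\<open>L\<close> is the sum of \<open>harm d - harm f\<close> and
    \<open>harm d - harm (d - f)\<close>, whose lower bounds add up to exactly 1. Thus a 1 \<ge> D -
    d = 1.\<close>
  have "(real d - real f) / real d + (real d - real (d - f)) / real d = 1"
    using f by (simp add: of_nat_diff field_simps)
  then have "L \<ge> 1"
    using harm_diff_ge[of f d] harm_diff_ge[of "d - f" d] f unfolding L_def by simp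
  then have "D * L \<ge> D" using D by simp
  then show "a 1 > 0" using a1 D by linarith
  have scale: "D\<^sup>2 * (L - harm2 f) + t > 0" if "harm2 f - L < t / D\<^sup>2" for t
  proof -
    have "(harm2 f - L) * D\<^sup>2 < t" using that D(1) by (subst (asm) pos_less_divide_eq) auto
    then show ?thesis by (simp add: algebra_simps)
  qed
  show "a 2 > 0"
  proof (cases "even d")
    case True
    then have d: "d = 2 * f" by (simp add: f_def)
    then have df: "d - f = f" by simp
    have L: "L = 2 * (harm (2 * f) - harm f)"
      unfolding L_def df d by simp
    have "coeff (cycle_ehrhart d) (Suc (Suc 0)) = - D\<^sup>2 * harm2 f + 2 * D * real d * L"
      unfolding coeffs(3) df L d[symmetric] using d by (simp add: field_simps)
    \<comment> \<open>The multiples of \<open>L\<close> combine as 2 * D * d - D * (d - 1) =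
      D^2.\<close>
    then have a2': "a 2 = D\<^sup>2 * (L - harm2 f) + real d * (real d - 1) / 2"
      unfolding a2 D(2) by (simp add: field_simps power2_eq_square)
    have "real d = 2 * real f" by (simp add: d)
    then have "harm2 f - L < real d * (real d - 1) / 2 / D\<^sup>2"
      using harm2_bound_even[OF f(1)] unfolding L D_def by (simp add: add.commute)
    then show ?thesis unfolding a2' by (rule scale)
  next
    case False
    then have d: "d = Suc (2 * f)" by (simp add: f_def)
    then have df: "d - f = Suc f" by simp
    have L: "L = 2 * harm (Suc (2 * f)) - harm f - harm (Suc f)"
      unfolding L_def df by (simp only: d)
    have Df: "D = 2 * (real f + 1)" by (simp add: D_def d)
    have half: "real (Suc f) = D / 2" and rf: "real f = D / 2 - 1" by (simp_all add: Df field_simps)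
    have H: "harm (Suc f) = harm f + 2 / D" "harm2 (Suc f) = harm2 f + 4 / D\<^sup>2"
      by (simp_all only: harm_Suc harm2_Suc half) (simp_all add: power_divide)
    have hd: "harm d = (L + 2 * harm f + 2 / D) / 2"
      unfolding L_def df H by simp
    \<comment> \<open>The squared difference (2 / D)^2 cancels the extra term of
      \<open>harm2 (Suc f)\<close>; the unequal halves f and f + 1 leave 4 * d - 4 * D = -4.\<close>
    have "coeff (cycle_ehrhart d) (Suc (Suc 0)) = - D\<^sup>2 * harm2 f + 2 * D * real d * L - 4"
      unfolding coeffs(3) df H hd D(2) half rf using D(1)
      by (simp add: field_simps power2_eq_square)
    then have a2': "a 2 = D\<^sup>2 * (L - harm2 f) + real d * (real d - 1) / 2 - 4"
      unfolding a2 D(2) by (simp add: field_simps power2_eq_square)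
    have "harm2 f - L < (2 * (real f)\<^sup>2 + real f - 4) / (4 * (real f + 1)\<^sup>2)"
      using harm2_bound_odd[OF f(1)] unfolding L .
    also have "\<dots> = (real d * (real d - 1) / 2 - 4) / D\<^sup>2"
      unfolding rf D(2) using D(1) by (simp add: field_simps power2_eq_square)
    finally show ?thesis unfolding a2' using scale by (simp only: add_diff_eq[symmetric])
  qed
qed

theorem theorem1p4:
  fixes E :: "'n::finite option set set"
    and d :: nat
    and a :: "nat \<Rightarrow> real"
  assumes "d = CARD('n)" and "d \<ge> 2"
    and "cycle_graph E"
    and "\<forall>x::real. poly (ehrhart_polynomial (polar_dual (forget_last ` symmetric_edge_polytope E))) x
           = (\<Sum>j\<le>d. a j * x ^ j * (1 + x) ^ (d - j))"
  shows "\<forall>i\<in>{0, 1, 2}. a i > 0 \<and> a (d - i) > 0"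
proof -
  have a: "poly (cycle_ehrhart d) x = (\<Sum>j\<le>d. a j * x ^ j * (1 + x) ^ (d - j))" for x
    using assms(4) by (simp add: ehrhart_polynomial_polar_dual_cycle[OF assms(3)] assms(1))
  \<comment> \<open>The substitution of -1 - x turns x^j * (1 + x)^(d - j) into (-1)^d * (1 + x)^j *
    x^(d - j), so the reflection symmetry reverses the coefficient sequence.\<close>
  have "poly (cycle_ehrhart d) x = (\<Sum>j\<le>d. a (d - j) * x ^ j * (1 + x) ^ (d - j))" for x
  proof -
    have "poly (cycle_ehrhart d) x = (-1) ^ d * poly (cycle_ehrhart d) (- 1 - x)"
      by (simp add: poly_cycle_ehrhart_reflect flip: mult.assoc power_mult_distrib)
    also have "\<dots> = (\<Sum>j\<le>d. (-1) ^ d * (a j * (- 1 - x) ^ j * (1 + (- 1 - x)) ^ (d - j)))"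
      unfolding a sum_distrib_left ..
    also have "\<dots> = (\<Sum>j\<le>d. a j * x ^ (d - j) * (1 + x) ^ j)"
    proof (intro sum.cong refl)
      fix j assume "j \<in> {..d}"
      then have "(-1 :: real) ^ d = (-1) ^ j * (-1) ^ (d - j)" by (simp flip: power_add)
      moreover have "(- 1 - x) ^ j = (-1) ^ j * (1 + x) ^ j"
        by (simp flip: power_mult_distrib)
      moreover have "(1 + (- 1 - x)) ^ (d - j) = (-1) ^ (d - j) * x ^ (d - j)"
        by (simp flip: power_mult_distrib)
      moreover have "(-1 :: real) ^ i * (-1) ^ i = 1" for i by (simp flip: power_mult_distrib)
      ultimately show "(-1) ^ d * (a j * (- 1 - x) ^ j * (1 + (- 1 - x)) ^ (d - j)) =
          a j * x ^ (d - j) * (1 + x) ^ j"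
        by (simp add: mult_ac)
    qed
    also have "\<dots> = (\<Sum>j\<le>d. a (d - j) * x ^ j * (1 + x) ^ (d - j))"
      by (rule sum.reindex_bij_witness[of _ "\<lambda>j. d - j" "\<lambda>j. d - j"]) auto
    finally show ?thesis .
  qed
  from cycle_ehrhart_expansion_pos[OF assms(2) a] cycle_ehrhart_expansion_pos[OF assms(2) this]
  show ?thesis by simp
qed

end
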